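(* Let $A$ be a finite $D$-set with $|A|\geq 2$ and let $\mathcal{C}$ be a splitting of $A$. Then $A$ may be extended to a $D$-set $A\cup\{e\}$ (with $e\notin A$, and with $A$ a substructure) such that $\mathcal{C}$ is the splitting of $A$ induced by $e$. Furthermore, the $D$-relation on $A\cup\{e\}$ is uniquely determined by the following properties, for $a,b,c\in A$: (1) $D(ab;ce)$ never holds if $a$ and $b$ lie in different sectors of $\mathcal{C}$; (2) if $a$ and $b$ lie in the same sector $\Sigma$ of $\mathcal{C}$, then $D(ab;ce)$ holds if and only if $D(ab;cx)$ holds for some (equivalently, every) $x\in A\setminus\Sigma$.
   Context: A $D$-set is a set $\Omega$ with a quaternary relation $D$, written $D(wx;yz)$, such that for all $w,x,y,z\in\Omega$: (D1) $D(wx;yz)\to (D(xw;yz)\wedge D(yz;wx))$; (D2) $D(wx;yz)\to\neg D(wy;xz)$; (D3) $D(wx;yz)\to\forall v\,(D(vx;yz)\vee D(wx;yv))$; (D4) $(w\neq y\wedge x\neq y)\to D(wx;yy)$. Any subset of a $D$-set with the restricted relation is a $D$-set. A splitting of a $D$-set $X$ is a partition of $X$ into at least two parts (sectors) such that (i) if $a,b$ lie in a part $\Sigma$ and $c,d\in X\setminus\Sigma$ then $D(ab;cd)$, and (ii) if $a,b,c,d$ lie in four distinct parts then $\neg D(ab;cd)$. If $A\cup\{e\}$ is a finite $D$-set with $e\notin A$ and $|A|\ge2$, the splitting of $A$ induced by $e$ is the unique splitting $\mathcal{C}$ of $A$ such that (1) whenever $a,b$ lie in some $\Sigma\in\mathcal{C}$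 and $c\in A\setminus\Sigma$, $D(ab;ce)$ holds, and (2) whenever $a,b$ lie in different members of $\mathcal{C}$, $\neg D(ab;xe)$ for all $x\in A$. *)

theory Defs
  imports Main "HOL-Library.Disjoint_Sets"
begin

text \<open>The relation \<open>D(wx;yz)\<close> is written \<open>D w x y z\<close>; only its values on the carrier matter.\<close>

definition D_set :: "'a set \<Rightarrow> ('a \<Rightarrow> 'a \<Rightarrow> 'a \<Rightarrow> 'a \<Rightarrow> bool) \<Rightarrow> bool" where
  "D_set \<Omega> D \<longleftrightarrow>
     (\<forall>w\<in>\<Omega>. \<forall>x\<in>\<Omega>. \<forall>y\<in>\<Omega>. \<forall>z\<in>\<Omega>.
        (D w x y z \<longrightarrow> D x w y z \<and> D y z w x) \<and>
        (D w x y z \<longrightarrow> \<not> D w y x z) \<and>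
        (D w x y z \<longrightarrow> (\<forall>v\<in>\<Omega>. D v x y z \<or> D w x y v)) \<and>
        (w \<noteq> y \<and> x \<noteq> y \<longrightarrow> D w x y y))"

definition splitting :: "'a set \<Rightarrow> ('a \<Rightarrow> 'a \<Rightarrow> 'a \<Rightarrow> 'a \<Rightarrow> bool) \<Rightarrow> 'a set set \<Rightarrow> bool" where
  "splitting X D \<C> \<longleftrightarrow>
     partition_on X \<C> \<and>
     (\<exists>\<Sigma>\<in>\<C>. \<exists>\<Sigma>'\<in>\<C>. \<Sigma> \<noteq> \<Sigma>') \<and>
     (\<forall>\<Sigma>\<in>\<C>. \<forall>a\<in>\<Sigma>. \<forall>b\<in>\<Sigma>. \<forall>c\<in>X - \<Sigma>. \<forall>d\<in>X - \<Sigma>. D a b c d) \<and>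
     (\<forall>\<Sigma>\<^sub>1\<in>\<C>. \<forall>\<Sigma>\<^sub>2\<in>\<C>. \<forall>\<Sigma>\<^sub>3\<in>\<C>. \<forall>\<Sigma>\<^sub>4\<in>\<C>.
        distinct [\<Sigma>\<^sub>1, \<Sigma>\<^sub>2, \<Sigma>\<^sub>3, \<Sigma>\<^sub>4] \<longrightarrow>
        (\<forall>a\<in>\<Sigma>\<^sub>1. \<forall>b\<in>\<Sigma>\<^sub>2. \<forall>c\<in>\<Sigma>\<^sub>3. \<forall>d\<in>\<Sigma>\<^sub>4. \<not> D a b c d))"

definition inducing_conditions ::
  "'a set \<Rightarrow> ('a \<Rightarrow> 'a \<Rightarrow> 'a \<Rightarrow> 'a \<Rightarrow> bool) \<Rightarrow> 'a \<Rightarrow> 'a set set \<Rightarrow> bool" where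
  "inducing_conditions A D e \<C> \<longleftrightarrow>
     (\<forall>\<Sigma>\<in>\<C>. \<forall>a\<in>\<Sigma>. \<forall>b\<in>\<Sigma>. \<forall>c\<in>A - \<Sigma>. D a b c e) \<and>
     (\<forall>\<Sigma>\<in>\<C>. \<forall>\<Sigma>'\<in>\<C>. \<Sigma> \<noteq> \<Sigma>' \<longrightarrow>
        (\<forall>a\<in>\<Sigma>. \<forall>b\<in>\<Sigma>'. \<forall>x\<in>A. \<not> D a b x e))"

text \<open>\<open>\<C>\<close> is the splitting of \<open>A\<close> induced by \<open>e\<close>, where \<open>D\<close> is a \<open>D\<close>-relation on
  \<open>insert e A\<close>; the last conjunct expresses the word ``unique'' in its definition.\<close>

definition is_induced_splitting ::
  "'a set \<Rightarrow> ('a \<Rightarrow> 'a \<Rightarrow> 'a \<Rightarrow> 'a \<Rightarrow> bool) \<Rightarrow> 'a \<Rightarrow> 'a set set \<Rightarrow> bool" where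
  "is_induced_splitting A D e \<C> \<longleftrightarrow>
     splitting A D \<C> \<and> inducing_conditions A D e \<C> \<and>
     (\<forall>\<C>'. splitting A D \<C>' \<and> inducing_conditions A D e \<C>' \<longrightarrow> \<C>' = \<C>)"

definition one_point_extension ::
  "'a set \<Rightarrow> ('a \<Rightarrow> 'a \<Rightarrow> 'a \<Rightarrow> 'a \<Rightarrow> bool) \<Rightarrow> 'a \<Rightarrow> ('a \<Rightarrow> 'a \<Rightarrow> 'a \<Rightarrow> 'a \<Rightarrow> bool) \<Rightarrow> bool" where
  "one_point_extension A D e D' \<longleftrightarrow>
     e \<notin> A \<and> D_set (insert e A) D' \<and>
     (\<forall>w\<in>A. \<forall>x\<in>A. \<forall>y\<in>A. \<forall>z\<in>A. D' w x y z \<longleftrightarrow> D w x y z)"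

definition determining_properties ::
  "'a set \<Rightarrow> ('a \<Rightarrow> 'a \<Rightarrow> 'a \<Rightarrow> 'a \<Rightarrow> bool) \<Rightarrow> 'a \<Rightarrow> 'a set set \<Rightarrow> bool" where
  "determining_properties A D e \<C> \<longleftrightarrow>
     (\<forall>\<Sigma>\<in>\<C>. \<forall>\<Sigma>'\<in>\<C>. \<Sigma> \<noteq> \<Sigma>' \<longrightarrow>
        (\<forall>a\<in>\<Sigma>. \<forall>b\<in>\<Sigma>'. \<forall>c\<in>A. \<not> D a b c e)) \<and>
     (\<forall>\<Sigma>\<in>\<C>. \<forall>a\<in>\<Sigma>. \<forall>b\<in>\<Sigma>. \<forall>c\<in>A.
        D a b c e \<longleftrightarrow> (\<exists>x\<in>A - \<Sigma>. D a b c x))"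

end

theory Submission
  imports Defs
begin

text \<open>Two points of \<open>A\<close> lie in the same sector of a splitting induced by \<open>e\<close> iff \<open>D(ab;ce)\<close> for
  some \<open>c \<in> A\<close>, so an induced splitting is determined by the relation. Conversely, a \<open>D\<close>-relation
  on \<open>A \<union> {e}\<close> is determined by its restriction to \<open>A\<close> and by the ternary relation \<open>D(ab;ce)\<close>:
  quadruples with more than one entry \<open>e\<close> are decided by the axioms. For a splitting, the
  truth of \<open>D(ab;cx)\<close> with \<open>a, b \<in> \<Sigma>\<close> does not depend on \<open>x \<notin> \<Sigma>\<close>, by (D2) and (D3); thus \<open>e\<close>
  can be made to behave, as seen from each sector, like any point outside that sector.\<close>

lemma D_set_swap_left:
  "\<lbrakk>D_set X D; D w x y z; w \<in> X; x \<in> X; y \<in> X; z \<in> X\<rbrakk> \<Longrightarrow> D x w y z"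
  unfolding D_set_def by blast

lemma D_set_swap_pairs:
  "\<lbrakk>D_set X D; D w x y z; w \<in> X; x \<in> X; y \<in> X; z \<in> X\<rbrakk> \<Longrightarrow> D y z w x"
  unfolding D_set_def by blast

lemma D_set_swap_right:
  "\<lbrakk>D_set X D; D w x y z; w \<in> X; x \<in> X; y \<in> X; z \<in> X\<rbrakk> \<Longrightarrow> D w x z y"
  by (meson D_set_swap_left D_set_swap_pairs)

lemma D_set_exclusive:
  "\<lbrakk>D_set X D; D w x y z; w \<in> X; x \<in> X; y \<in> X; z \<in> X\<rbrakk> \<Longrightarrow> \<not> D w y x z"
  unfolding D_set_def by blast

lemma D_set_replace:
  "\<lbrakk>D_set X D; D w x y z; w \<in> X; x \<in> X; y \<in> X; z \<in> X; v \<in> X\<rbrakk> \<Longrightarrow> D v x y z \<or> D w x y v"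
  unfolding D_set_def by blast

lemma D_set_degenerate:
  "\<lbrakk>D_set X D; w \<in> X; x \<in> X; y \<in> X; w \<noteq> y; x \<noteq> y\<rbrakk> \<Longrightarrow> D w x y y"
  unfolding D_set_def by blast

text \<open>A point on both sides is impossible. If \<open>x\<close> and \<open>y\<close> differ
  from \<open>w\<close>, then (D4) gives \<open>D w w x y\<close>, which (D2) excludes.\<close>

lemma D_set_disjoint:
  assumes D: "D_set X D" and X: "w \<in> X" "x \<in> X" "y \<in> X" and "D w x w y"
  shows False
proof -
  \<comment> \<open>With three equal entries, (D2) makes the statement its own negation. This rules
    out \<open>x = w\<close> and \<open>y = w\<close>.\<close>
  have no_triple: "\<not> D w w w u" if "u \<in> X" for u
    using D_set_exclusive[OF D, of w w w u] X that by blast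
  have "x \<noteq> w" "y \<noteq> w"
    using assms no_triple D_set_swap_pairs[OF D, of w x w y] D_set_swap_right[OF D, of w w w x]
    by blast+
  then have "D w w x y"
    using D_set_degenerate[OF D, of x y w] D_set_swap_pairs[OF D] X by blast
  then show False
    using D_set_exclusive[OF D] assms by blast
qed

section \<open>Recovering a D-relation from a ternary relation\<close>

text \<open>\<open>T a b c\<close> plays the role of \<open>D a b c e\<close>. The first three cases
  settle two or more entries \<open>e\<close>: a pair of them forms one side, as in (D4), or they
  occur on both sides. The next four use the symmetries of (D1) to move a single \<open>e\<close> to
  the last place.\<close>

definition extend_by :: "'a \<Rightarrow> ('a \<Rightarrow> 'a \<Rightarrow> 'a \<Rightarrow> 'a \<Rightarrow> bool) \<Rightarrow> ('a \<Rightarrow> 'a \<Rightarrow> 'a \<Rightarrow> bool)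
    \<Rightarrow> 'a \<Rightarrow> 'a \<Rightarrow> 'a \<Rightarrow> 'a \<Rightarrow> bool" where
  "extend_by e D T w x y z =
     (if w = e \<and> x = e then y \<noteq> e \<and> z \<noteq> e
      else if y = e \<and> z = e then w \<noteq> e \<and> x \<noteq> e
      else if (w = e \<or> x = e) \<and> (y = e \<or> z = e) then False
      else if w = e then T y z x
      else if x = e then T y z w
      else if y = e then T w x z
      else if z = e then T w x y
      else D w x y z)"

text \<open>Each branch of \<open>extend_by\<close> is forced: an entry on both sides contradicts
  \<open>D_set_disjoint\<close>, a side \<open>e\<close>, \<open>e\<close> is decided by that fact
  and (D4), and the rest is (D1).\<close>

lemma D_set_eq_extend_by:
  assumes D: "D_set (insert e A) D"
    and X: "w \<in> insert e A" "x \<in> insert e A" "y \<in> insert e A" "z \<in> insert e A"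
  shows "D w x y z \<longleftrightarrow> extend_by e D (\<lambda>a b c. D a b c e) w x y z"
proof -
  have "\<not> D w x y z" if disj: "{w, x} \<inter> {y, z} \<noteq> {}"
  proof
    assume wxyz: "D w x y z"
    have perms: "D w x z y" "D x w y z" "D x w z y"
      using wxyz X D_set_swap_left[OF D] D_set_swap_right[OF D] by blast+
    consider "w = y" | "w = z" | "x = y" | "x = z"
      using disj by blast
    then show False
      using X D_set_disjoint[OF D, of w x z] D_set_disjoint[OF D, of w x y]
        D_set_disjoint[OF D, of x w z] D_set_disjoint[OF D, of x w y] wxyz perms
      by cases simp_all
  qed
  moreover have "D w x y z \<longleftrightarrow> D x w y z" "D w x y z \<longleftrightarrow> D w x z y" "D w x y z \<longleftrightarrow> D y z w x"
    "D y z w x \<longleftrightarrow> D y z x w"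
    using X D_set_swap_left[OF D] D_set_swap_right[OF D] D_set_swap_pairs[OF D] by blast+
  moreover have "D w x y y" if "w \<noteq> y" "x \<noteq> y"
    using D_set_degenerate[OF D] X that by blast
  moreover have "D w w y z" if "y \<noteq> w" "z \<noteq> w"
    using D_set_degenerate[OF D, of y z w] D_set_swap_pairs[OF D] X that by blast
  ultimately show ?thesis
    unfolding extend_by_def by auto
qed

section \<open>Splittings and points outside a sector\<close>

text \<open>Both determining properties turned into a definition: the relation fails across sectors,
  and inside \<Sigma> the point \<open>e\<close> is replaced by a point \<open>x\<close> outside
  \<Sigma>.\<close>

definition sector_relation ::
  "'a set \<Rightarrow> ('a \<Rightarrow> 'a \<Rightarrow> 'a \<Rightarrow> 'a \<Rightarrow> bool) \<Rightarrow> 'a set set \<Rightarrow> 'a \<Rightarrow> 'a \<Rightarrow> 'a \<Rightarrow> bool" where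
  "sector_relation A D \<C> a b c \<longleftrightarrow> (\<exists>\<Sigma>\<in>\<C>. a \<in> \<Sigma> \<and> b \<in> \<Sigma> \<and> (\<exists>x\<in>A - \<Sigma>. D a b c x))"

lemma splitting_partition: "splitting A D \<C> \<Longrightarrow> partition_on A \<C>"
  unfolding splitting_def by blast

lemma splitting_separates:
  "\<lbrakk>splitting A D \<C>; \<Sigma> \<in> \<C>; a \<in> \<Sigma>; b \<in> \<Sigma>; c \<in> A - \<Sigma>; d \<in> A - \<Sigma>\<rbrakk> \<Longrightarrow> D a b c d"
  unfolding splitting_def by blast

lemma splitting_transversal:
  "\<lbrakk>splitting A D \<C>; P \<in> \<C>; Q \<in> \<C>; R \<in> \<C>; T \<in> \<C>; distinct [P, Q, R, T];
    a \<in> P; b \<in> Q; c \<in> R; d \<in> T\<rbrakk> \<Longrightarrow> \<not> D a b c d"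
  unfolding splitting_def by metis

lemma splitting_sector_subset: "\<lbrakk>splitting A D \<C>; \<Sigma> \<in> \<C>\<rbrakk> \<Longrightarrow> \<Sigma> \<subseteq> A"
  using splitting_partition partition_onD1 by blast

lemma splitting_sector_unique:
  "\<lbrakk>splitting A D \<C>; \<Sigma> \<in> \<C>; \<Sigma>' \<in> \<C>; a \<in> \<Sigma>; a \<in> \<Sigma>'\<rbrakk> \<Longrightarrow> \<Sigma> = \<Sigma>'"
  using splitting_partition partition_onD2 disjointD by (metis disjoint_iff)

lemma splitting_sector_exists: "\<lbrakk>splitting A D \<C>; a \<in> A\<rbrakk> \<Longrightarrow> \<exists>\<Sigma>\<in>\<C>. a \<in> \<Sigma>"
  using splitting_partition partition_onD1 by (metis UnionE)

lemma splitting_complement_nonempty: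
  assumes S: "splitting A D \<C>" and "\<Sigma> \<in> \<C>"
  shows "\<exists>x. x \<in> A - \<Sigma>"
proof -
  obtain \<Sigma>' where \<Sigma>': "\<Sigma>' \<in> \<C>" "\<Sigma>' \<noteq> \<Sigma>"
    using S unfolding splitting_def by metis
  then obtain x where "x \<in> \<Sigma>'"
    using splitting_partition[OF S] partition_onD3 by fastforce
  then show ?thesis
    using \<Sigma>' splitting_sector_unique[OF S] splitting_sector_subset[OF S] assms(2) by blast
qed

text \<open>For \<open>c\<close> in \<Sigma>, (D3) leaves \<open>D y b c x\<close> or
  \<open>D a b c y\<close>. The splitting gives \<open>D b c y x\<close>, and (D2) then excludes the
  former. For \<open>c\<close> outside \<Sigma> the splitting gives the conclusion directly.\<close>

lemma splitting_outside_independent: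
  assumes D: "D_set A D" and S: "splitting A D \<C>" and \<Sigma>: "\<Sigma> \<in> \<C>" "a \<in> \<Sigma>" "b \<in> \<Sigma>"
    and "c \<in> A" "x \<in> A - \<Sigma>" "y \<in> A - \<Sigma>" "D a b c x"
  shows "D a b c y"
proof (cases "c \<in> \<Sigma>")
  case True
  then have "\<not> D b y c x"
    using D_set_exclusive[OF D, of b c y x] splitting_separates[OF S] splitting_sector_subset[OF S] assms
    by blast
  then show ?thesis
    using D_set_replace[OF D, of a b c x y] D_set_swap_left[OF D, of y b c x]
      splitting_sector_subset[OF S] assms by blast
next
  case False
  then show ?thesis
    using assms splitting_separates[OF S] by blast
qed

section \<open>The axioms for the sector relation\<close>

text \<open>A single reference point \<open>x\<close> outside the sector of \<open>a\<close> serves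
  for all \<open>b\<close> and \<open>c\<close>, so instances of the axioms at \<open>x\<close>
  carry over to the relation.\<close>

lemma sector_relation_iff:
  assumes D: "D_set A D" and S: "splitting A D \<C>" and \<Sigma>: "\<Sigma> \<in> \<C>" "a \<in> \<Sigma>"
    and x: "x \<in> A - \<Sigma>" and c: "c \<in> A"
  shows "sector_relation A D \<C> a b c \<longleftrightarrow> b \<in> \<Sigma> \<and> D a b c x"
proof
  assume "sector_relation A D \<C> a b c"
  then obtain \<Sigma>' y where "\<Sigma>' \<in> \<C>" "a \<in> \<Sigma>'" "b \<in> \<Sigma>'" "y \<in> A - \<Sigma>'" "D a b c y"
    unfolding sector_relation_def by blast
  then show "b \<in> \<Sigma> \<and> D a b c x"
    using splitting_sector_unique[OF S, of \<Sigma> \<Sigma>' a]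
      splitting_outside_independent[OF D S, of \<Sigma> a b c y x] assms by blast
next
  assume "b \<in> \<Sigma> \<and> D a b c x"
  then show "sector_relation A D \<C> a b c"
    unfolding sector_relation_def using assms by blast
qed

lemma sector_relation_commute:
  assumes D: "D_set A D" and S: "splitting A D \<C>" and "c \<in> A"
  shows "sector_relation A D \<C> a b c \<longleftrightarrow> sector_relation A D \<C> b a c"
proof -
  have "sector_relation A D \<C> q p c" if T: "sector_relation A D \<C> p q c" for p q
  proof -
    obtain \<Sigma> x where \<Sigma>: "\<Sigma> \<in> \<C>" "p \<in> \<Sigma>" "q \<in> \<Sigma>" and x: "x \<in> A - \<Sigma>" "D p q c x"
      using T unfolding sector_relation_def by blast
    then have "D q p c x"
      using D_set_swap_left[OF D, of p q c x] splitting_sector_subset[OF S \<Sigma>(1)] \<open>c \<in> A\<close> by blast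
    then show ?thesis
      using \<Sigma> x unfolding sector_relation_def by blast
  qed
  then show ?thesis
    by blast
qed

lemma sector_relation_exclusive:
  assumes D: "D_set A D" and S: "splitting A D \<C>" and "a \<in> A" "b \<in> A" "c \<in> A"
    and T: "sector_relation A D \<C> a b c"
  shows "\<not> sector_relation A D \<C> a c b"
proof -
  obtain \<Sigma> where \<Sigma>: "\<Sigma> \<in> \<C>" "a \<in> \<Sigma>"
    using splitting_sector_exists[OF S] assms by blast
  obtain x where x: "x \<in> A - \<Sigma>"
    using splitting_complement_nonempty[OF S] \<Sigma> by blast
  show ?thesis
    using sector_relation_iff[OF D S \<Sigma> x] D_set_exclusive[OF D, of a b c x] assms x by blast
qed

text \<open>This is (D3) for \<open>D(ab;ce)\<close>, where \<open>e\<close> is the entry replaced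
  by \<open>v\<close>. Inside the sector, (D3) is applied with \<open>x\<close> in place of
  \<open>e\<close>; outside it, \<open>v\<close> is itself a possible reference point.\<close>

lemma sector_relation_replace_right:
  assumes D: "D_set A D" and S: "splitting A D \<C>" and "a \<in> A" "b \<in> A" "c \<in> A" "v \<in> A"
    and T: "sector_relation A D \<C> a b c"
  shows "sector_relation A D \<C> v b c \<or> D a b c v"
proof -
  obtain \<Sigma> where \<Sigma>: "\<Sigma> \<in> \<C>" "b \<in> \<Sigma>"
    using splitting_sector_exists[OF S] assms by blast
  obtain x where x: "x \<in> A - \<Sigma>"
    using splitting_complement_nonempty[OF S] \<Sigma> by blast
  have a: "a \<in> \<Sigma>" "D a b c x"
    using sector_relation_iff[OF D S \<Sigma> x, of c a] sector_relation_commute[OF D S, of c a b]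
      D_set_swap_left[OF D, of b a c x] assms x by blast+
  show ?thesis
  proof (cases "v \<in> \<Sigma>")
    case True
    then show ?thesis
      using D_set_replace[OF D, of a b c x v] assms a x \<Sigma> unfolding sector_relation_def by blast
  next
    case False
    then show ?thesis
      using splitting_outside_independent[OF D S \<Sigma>(1), of a b c x v] a \<Sigma> x assms by blast
  qed
qed

text \<open>This is (D3) for \<open>D(ab;ec)\<close>, where \<open>e\<close> stays and
  \<open>c\<close> is replaced.\<close>

lemma sector_relation_replace_left:
  assumes D: "D_set A D" and S: "splitting A D \<C>" and "a \<in> A" "b \<in> A" "c \<in> A" "v \<in> A"
    and T: "sector_relation A D \<C> a b c"
  shows "sector_relation A D \<C> v b c \<or> sector_relation A D \<C> a b v"
proof -
  obtain \<Sigma> x where \<Sigma>: "\<Sigma> \<in> \<C>" "a \<in> \<Sigma>" "b \<in> \<Sigma>" and x: "x \<in> A - \<Sigma>" "D a b c x"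
    using T unfolding sector_relation_def by blast
  show ?thesis
  proof (cases "v \<in> \<Sigma>")
    case True
    have "D v b x c \<or> D a b x v"
      using D_set_replace[OF D, of a b x c v] D_set_swap_right[OF D, of a b c x] assms x by blast
    then have "D v b c x \<or> D a b v x"
      using D_set_swap_right[OF D] assms x by blast
    then show ?thesis
      using True \<Sigma> x unfolding sector_relation_def by blast
  next
    case False
    \<comment> \<open>Outside the sector, \<open>v\<close> itself witnesses
      \<open>sector_relation A D \<C> a b v\<close>.\<close>
    then have "D a b v v"
      using splitting_separates[OF S \<Sigma>] assms by blast
    then show ?thesis
      using False \<Sigma> \<open>v \<in> A\<close> unfolding sector_relation_def by blast
  qed
qed

text \<open>The conclusion is (D3) for \<open>D(wx;yz)\<close> with the new point \<open>e\<close>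
  as \<open>v\<close>. If \<open>y\<close> and \<open>z\<close> also lie in \<Sigma>, an outside
  point \<open>u\<close> stands in for \<open>e\<close> in both alternatives. Otherwise the second
  alternative holds outright.\<close>

lemma sector_relation_of_D_same_sector:
  assumes D: "D_set A D" and S: "splitting A D \<C>" and A: "w \<in> A" "x \<in> A" "y \<in> A" "z \<in> A"
    and "D w x y z" and \<Sigma>: "\<Sigma> \<in> \<C>" "w \<in> \<Sigma>" "x \<in> \<Sigma>"
  shows "sector_relation A D \<C> y z x \<or> sector_relation A D \<C> w x y"
proof -
  obtain u where u: "u \<in> A - \<Sigma>"
    using splitting_complement_nonempty[OF S] \<Sigma> by blast
  consider "y \<notin> \<Sigma>" | "y \<in> \<Sigma>" "z \<notin> \<Sigma>" | "y \<in> \<Sigma>" "z \<in> \<Sigma>" by blast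
  then show ?thesis
  proof cases
    case 1
    then have "D w x y u"
      using splitting_separates[OF S \<Sigma>] u A by blast
    then show ?thesis
      using \<Sigma> u unfolding sector_relation_def by blast
  next
    case 2
    then show ?thesis
      using assms unfolding sector_relation_def by blast
  next
    case 3
    have "D y z x u \<or> D w x y u"
      using D_set_replace[OF D, of w x y z u] D_set_swap_pairs[OF D, of u x y z]
        D_set_swap_right[OF D, of y z u x] assms u by blast
    then show ?thesis
      using 3 \<Sigma> u unfolding sector_relation_def by blast
  qed
qed

text \<open>If neither side of \<open>D w x y z\<close> lies within one sector, the four sectors are
  pairwise distinct, which \<open>splitting_transversal\<close> forbids. The other cases reduce by
  symmetry to the previous lemma.\<close>

lemma sector_relation_of_D:
  assumes D: "D_set A D" and S: "splitting A D \<C>" and A: "w \<in> A" "x \<in> A" "y \<in> A" "z \<in> A"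
    and wxyz: "D w x y z"
  shows "sector_relation A D \<C> y z x \<or> sector_relation A D \<C> w x y"
proof -
  obtain W where W: "W \<in> \<C>" "w \<in> W" using splitting_sector_exists[OF S] A by blast
  obtain X where X: "X \<in> \<C>" "x \<in> X" using splitting_sector_exists[OF S] A by blast
  obtain Y where Y: "Y \<in> \<C>" "y \<in> Y" using splitting_sector_exists[OF S] A by blast
  obtain Z where Z: "Z \<in> \<C>" "z \<in> Z" using splitting_sector_exists[OF S] A by blast
  have notin: "p \<in> A - P" if "P \<in> \<C>" "Q \<in> \<C>" "p \<in> Q" "P \<noteq> Q" for P Q p
    using that splitting_sector_unique[OF S] splitting_sector_subset[OF S] by blast
  \<comment> \<open>A sector containing exactly one point of each side is impossible: separation
    gives \<open>D p r q s\<close>, against (D2).\<close>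
  have crossing: "\<not> D p q r s"
    if "P \<in> \<C>" "p \<in> P" "r \<in> P" "q \<in> A - P" "s \<in> A - P" for P p q r s
    using D_set_exclusive[OF D, of p r q s] splitting_separates[OF S, of P p r q s]
      splitting_sector_subset[OF S] that by blast
  consider "W = X" | "Y = Z" | "W \<noteq> X" "Y \<noteq> Z" by blast
  then show ?thesis
  proof cases
    case 1
    then show ?thesis
      using sector_relation_of_D_same_sector[OF D S A wxyz] W X by blast
  next
    case 2
    have "D z y x w"
      using wxyz A D_set_swap_pairs[OF D] D_set_swap_left[OF D] D_set_swap_right[OF D] by meson
    then have "sector_relation A D \<C> x w y \<or> sector_relation A D \<C> z y x"
      using sector_relation_of_D_same_sector[OF D S A(4) A(3) A(2) A(1)] 2 Y Z by blast
    then show ?thesis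
      using sector_relation_commute[OF D S] A by blast
  next
    case 3
    have perms: "D w x z y" "D x w y z" "D x w z y"
      using wxyz A D_set_swap_left[OF D] D_set_swap_right[OF D] by blast+
    have "W \<noteq> Y" using crossing[of W w y x z] notin W X Y Z 3 wxyz by metis
    moreover have "W \<noteq> Z" using crossing[of W w z x y] notin W X Y Z 3 perms by metis
    moreover have "X \<noteq> Y" using crossing[of X x y w z] notin W X Y Z 3 perms by metis
    moreover have "X \<noteq> Z" using crossing[of X x z w y] notin W X Y Z 3 perms by metis
    ultimately have "distinct [W, X, Y, Z]" using 3 by simp
    then show ?thesis
      using splitting_transversal[OF S, of W X Y Z w x y z] W X Y Z wxyz by simp
  qed
qed

text \<open>Cases on the positions of \<open>e\<close>. For (D3) with a single \<open>e\<close>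
  among the five points, \<open>sector_relation_replace_left\<close> covers \<open>e\<close> at
  \<open>x\<close> or \<open>y\<close>, \<open>sector_relation_replace_right\<close> covers
  \<open>e\<close> at the replaced places \<open>w\<close> or \<open>z\<close>, and
  \<open>sector_relation_of_D\<close> covers \<open>v = e\<close>.\<close>

lemma D_set_extend_by_sector_relation:
  assumes D: "D_set A D" and S: "splitting A D \<C>" and e: "e \<notin> A"
  shows "D_set (insert e A) (extend_by e D (sector_relation A D \<C>))"
proof -
  let ?T = "sector_relation A D \<C>"
  let ?E = "extend_by e D ?T"
  have swap: "?E w x y z \<longrightarrow> ?E x w y z \<and> ?E y z w x"
    if "w \<in> insert e A" "x \<in> insert e A" "y \<in> insert e A" "z \<in> insert e A" for w x y z
    using that e sector_relation_commute[OF D S, of x y z] sector_relation_commute[OF D S, of w y z]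
      sector_relation_commute[OF D S, of y w x] sector_relation_commute[OF D S, of z w x]
      D_set_swap_left[OF D, of w x y z] D_set_swap_pairs[OF D, of w x y z]
    unfolding extend_by_def by auto
  have exclusive: "?E w x y z \<longrightarrow> \<not> ?E w y x z"
    if "w \<in> insert e A" "x \<in> insert e A" "y \<in> insert e A" "z \<in> insert e A" for w x y z
    using that e sector_relation_exclusive[OF D S, of w x y] sector_relation_exclusive[OF D S, of x w z]
      sector_relation_exclusive[OF D S, of z y x] sector_relation_exclusive[OF D S, of y z w]
      sector_relation_commute[OF D S, of x y z] sector_relation_commute[OF D S, of y x z]
      sector_relation_commute[OF D S, of z w x] sector_relation_commute[OF D S, of z w y]
      D_set_exclusive[OF D, of w x y z]
    unfolding extend_by_def by (auto split: if_splits)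
  have replace: "?E v x y z \<or> ?E w x y v"
    if "w \<in> insert e A" "x \<in> insert e A" "y \<in> insert e A" "z \<in> insert e A" "v \<in> insert e A"
      "?E w x y z" for w x y z v
  proof -
    \<comment> \<open>For \<open>w = e\<close> the right replacement yields
      \<open>D z y x v\<close>, the reversal of the quadruple required.\<close>
    have DA: "D v x y z" if "D z y x v" "x \<in> A" "y \<in> A" "z \<in> A" "v \<in> A"
      using that D_set_swap_left[OF D] D_set_swap_right[OF D] D_set_swap_pairs[OF D] by meson
    show ?thesis
      using that e DA sector_relation_replace_left[OF D S, of w x z v]
        sector_relation_replace_left[OF D S, of z y w v]
        sector_relation_replace_right[OF D S, of w x y v]
        sector_relation_replace_right[OF D S, of z y x v] sector_relation_of_D[OF D S, of w x y z]
        sector_relation_commute[OF D S, of x y z] sector_relation_commute[OF D S, of x y v]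
        sector_relation_commute[OF D S, of w y z] sector_relation_commute[OF D S, of w y v]
        sector_relation_commute[OF D S, of v y z] D_set_replace[OF D, of w x y z v]
      unfolding extend_by_def by (auto split: if_splits)
  qed
  \<comment> \<open>This is (D4) when exactly one of the two unequal-to-\<open>y\<close> entries is
    \<open>e\<close>: \<open>D(ex;yy)\<close> is encoded as \<open>?T y y x\<close>.\<close>
  have degenerate_e: "?T y y x" if "x \<in> A" "y \<in> A" "x \<noteq> y" for x y
  proof -
    obtain \<Sigma> where \<Sigma>: "\<Sigma> \<in> \<C>" "y \<in> \<Sigma>"
      using splitting_sector_exists[OF S] \<open>y \<in> A\<close> by blast
    obtain u where u: "u \<in> A - \<Sigma>"
      using splitting_complement_nonempty[OF S] \<Sigma> by blast
    then have "D y y x u"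
      using D_set_degenerate[OF D, of x u y] D_set_swap_pairs[OF D] that \<Sigma> by blast
    then show ?thesis
      using \<Sigma> u unfolding sector_relation_def by blast
  qed
  have degenerate: "?E w x y y"
    if "w \<in> insert e A" "x \<in> insert e A" "y \<in> insert e A" "w \<noteq> y" "x \<noteq> y" for w x y
    using that D_set_degenerate[OF D] degenerate_e unfolding extend_by_def by auto
  show ?thesis
  proof (unfold D_set_def, intro ballI conjI)
    fix w x y z
    assume X: "w \<in> insert e A" "x \<in> insert e A" "y \<in> insert e A" "z \<in> insert e A"
    show "?E w x y z \<longrightarrow> ?E x w y z \<and> ?E y z w x" using swap[OF X] .
    show "?E w x y z \<longrightarrow> \<not> ?E w y x z" using exclusive[OF X] .
    show "?E w x y z \<longrightarrow> (\<forall>v\<in>insert e A. ?E v x y z \<or> ?E w x y v)"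
      by (intro impI ballI) (rule replace[OF X])
    show "w \<noteq> y \<and> x \<noteq> y \<longrightarrow> ?E w x y y"
      by (intro impI, elim conjE) (rule degenerate[OF X(1-3)])
  qed
qed

section \<open>Induced splittings\<close>

lemma inducing_conditions_same_sector:
  "\<lbrakk>inducing_conditions A D e \<C>; \<Sigma> \<in> \<C>; a \<in> \<Sigma>; b \<in> \<Sigma>; c \<in> A - \<Sigma>\<rbrakk> \<Longrightarrow> D a b c e"
  unfolding inducing_conditions_def by metis

lemma inducing_conditions_distinct_sectors:
  "\<lbrakk>inducing_conditions A D e \<C>; \<Sigma> \<in> \<C>; \<Sigma>' \<in> \<C>; \<Sigma> \<noteq> \<Sigma>'; a \<in> \<Sigma>; b \<in> \<Sigma>'; x \<in> A\<rbrakk>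
    \<Longrightarrow> \<not> D a b x e"
  unfolding inducing_conditions_def by metis

lemma inducing_conditions_same_sector_iff:
  assumes S: "splitting A D \<C>" and I: "inducing_conditions A D e \<C>" and "a \<in> A" "b \<in> A"
  shows "(\<exists>\<Sigma>\<in>\<C>. a \<in> \<Sigma> \<and> b \<in> \<Sigma>) \<longleftrightarrow> (\<exists>c\<in>A. D a b c e)"
proof
  assume "\<exists>\<Sigma>\<in>\<C>. a \<in> \<Sigma> \<and> b \<in> \<Sigma>"
  then obtain \<Sigma> c where "\<Sigma> \<in> \<C>" "a \<in> \<Sigma>" "b \<in> \<Sigma>" "c \<in> A - \<Sigma>"
    using splitting_complement_nonempty[OF S] by blast
  then show "\<exists>c\<in>A. D a b c e"
    using inducing_conditions_same_sector[OF I] by blast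
next
  assume "\<exists>c\<in>A. D a b c e"
  then show "\<exists>\<Sigma>\<in>\<C>. a \<in> \<Sigma> \<and> b \<in> \<Sigma>"
    using splitting_sector_exists[OF S \<open>a \<in> A\<close>] splitting_sector_exists[OF S \<open>b \<in> A\<close>]
      inducing_conditions_distinct_sectors[OF I] by metis
qed

text \<open>Membership in a common sector is expressed through \<open>D\<close> and \<open>e\<close>
  alone, so both splittings have the same sector around each point. The hypotheses are symmetric, so
  one inclusion yields uniqueness.\<close>

lemma inducing_conditions_subset:
  assumes S: "splitting A D \<C>" "inducing_conditions A D e \<C>"
    and S': "splitting A D \<C>'" "inducing_conditions A D e \<C>'"
  shows "\<C> \<subseteq> \<C>'"
proof
  fix \<Sigma> assume \<Sigma>: "\<Sigma> \<in> \<C>"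
  then obtain a where a: "a \<in> \<Sigma>"
    using splitting_partition[OF S(1)] partition_onD3 by fastforce
  then have "a \<in> A"
    using splitting_sector_subset[OF S(1)] \<Sigma> by blast
  then obtain \<Sigma>' where \<Sigma>': "\<Sigma>' \<in> \<C>'" "a \<in> \<Sigma>'"
    using splitting_sector_exists[OF S'(1)] by blast
  have "b \<in> \<Sigma> \<longleftrightarrow> b \<in> \<Sigma>'" if "b \<in> A" for b
    using inducing_conditions_same_sector_iff[OF S \<open>a \<in> A\<close> that]
      inducing_conditions_same_sector_iff[OF S' \<open>a \<in> A\<close> that]
      splitting_sector_unique[OF S(1)] splitting_sector_unique[OF S'(1)] a \<Sigma> \<Sigma>' by blast
  then have "\<Sigma> = \<Sigma>'"
    using splitting_sector_subset[OF S(1) \<Sigma>] splitting_sector_subset[OF S'(1) \<Sigma>'(1)] by blast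
  then show "\<Sigma> \<in> \<C>'" using \<Sigma>' by blast
qed

lemma is_induced_splittingI:
  assumes "splitting A D \<C>" "inducing_conditions A D e \<C>"
  shows "is_induced_splitting A D e \<C>"
  unfolding is_induced_splitting_def
  using assms inducing_conditions_subset by (metis subset_antisym)

lemma splitting_cong:
  assumes "\<forall>w\<in>A. \<forall>x\<in>A. \<forall>y\<in>A. \<forall>z\<in>A. D' w x y z \<longleftrightarrow> D w x y z" and S: "splitting A D \<C>"
  shows "splitting A D' \<C>"
proof -
  have "\<Sigma> \<subseteq> A" if "\<Sigma> \<in> \<C>" for \<Sigma>
    using splitting_sector_subset[OF S that] .
  then show ?thesis
    using assms unfolding splitting_def by (simp add: subset_iff)
qed

lemma inducing_conditions_sector_relation:
  assumes S: "splitting A D \<C>" and e: "e \<notin> A"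
  shows "inducing_conditions A (extend_by e D (sector_relation A D \<C>)) e \<C>"
proof -
  have eq: "extend_by e D (sector_relation A D \<C>) a b c e \<longleftrightarrow> sector_relation A D \<C> a b c"
    if "a \<in> A" "b \<in> A" "c \<in> A" for a b c
    using that e unfolding extend_by_def by auto
  have "extend_by e D (sector_relation A D \<C>) a b c e"
    if "\<Sigma> \<in> \<C>" "a \<in> \<Sigma>" "b \<in> \<Sigma>" "c \<in> A - \<Sigma>" for \<Sigma> a b c
    \<comment> \<open>The witness outside \<Sigma> is \<open>c\<close> itself, by
      \<open>D a b c c\<close>.\<close>
    using that eq splitting_separates[OF S that that(4)] splitting_sector_subset[OF S]
    unfolding sector_relation_def by blast
  moreover have "\<not> extend_by e D (sector_relation A D \<C>) a b c e"
    if "\<Sigma> \<in> \<C>" "\<Sigma>' \<in> \<C>" "\<Sigma> \<noteq> \<Sigma>'" "a \<in> \<Sigma>" "b \<in> \<Sigma>'" "c \<in> A" for \<Sigma> \<Sigma>' a b c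
    using that eq[of a b c] splitting_sector_unique[OF S] splitting_sector_subset[OF S]
    unfolding sector_relation_def by blast
  ultimately show ?thesis
    unfolding inducing_conditions_def by blast
qed

section \<open>The determining properties and uniqueness\<close>

text \<open>For each sector, \<open>e\<close> behaves like a point outside it, so the argument of
  \<open>splitting_outside_independent\<close> exchanges \<open>e\<close> and
  \<open>x\<close>.\<close>

lemma determining_properties_if_inducing_conditions:
  assumes D: "D_set (insert e A) D" and S: "splitting A D \<C>" and I: "inducing_conditions A D e \<C>"
  shows "determining_properties A D e \<C>"
proof -
  have I1: "D a b c e" if "\<Sigma> \<in> \<C>" "a \<in> \<Sigma>" "b \<in> \<Sigma>" "c \<in> A - \<Sigma>" for \<Sigma> a b c
    using inducing_conditions_same_sector[OF I that] .
  have I2: "\<not> D a b c e" if "\<Sigma> \<in> \<C>" "a \<in> A - \<Sigma>" "b \<in> \<Sigma>" "c \<in> A" for \<Sigma> a b c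
    using that splitting_sector_exists[OF S, of a] inducing_conditions_distinct_sectors[OF I] by blast
  have "D a b c e \<longleftrightarrow> (\<exists>x\<in>A - \<Sigma>. D a b c x)"
    if \<Sigma>: "\<Sigma> \<in> \<C>" "a \<in> \<Sigma>" "b \<in> \<Sigma>" and c: "c \<in> A" for \<Sigma> a b c
  proof (cases "c \<in> \<Sigma>")
    case False
    then show ?thesis
      using I1[OF \<Sigma>] splitting_separates[OF S \<Sigma>] c by blast
  next
    case True
    have A: "a \<in> insert e A" "b \<in> insert e A" "c \<in> insert e A"
      using \<Sigma> c splitting_sector_subset[OF S] by blast+
    obtain x where x: "x \<in> A - \<Sigma>"
      using splitting_complement_nonempty[OF S \<Sigma>(1)] by blast
    show ?thesis
    proof
      assume "D a b c e"
      then show "\<exists>x\<in>A - \<Sigma>. D a b c x"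
        \<comment> \<open>The alternative \<open>D x b c e\<close> fails because \<open>x\<close>
          and \<open>b\<close> lie in different sectors.\<close>
        using D_set_replace[OF D, of a b c e x] I2[OF \<Sigma>(1) x \<Sigma>(3) c] A x by blast
    next
      assume "\<exists>x\<in>A - \<Sigma>. D a b c x"
      then obtain y where y: "y \<in> A - \<Sigma>" "D a b c y" by blast
      \<comment> \<open>As \<open>b\<close> and \<open>c\<close> share a sector that misses
        \<open>y\<close>, this holds, and (D2) then excludes the alternative
        \<open>D e b c y\<close> left by (D3).\<close>
      have "D b c e y"
        using I1[OF \<Sigma>(1,3) True y(1)] D_set_swap_right[OF D] A y by blast
      then have "\<not> D e b c y"
        using D_set_exclusive[OF D, of b c e y] D_set_swap_left[OF D, of e b c y] A y by blast
      then show "D a b c e"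
        using D_set_replace[OF D, of a b c y e] A y by blast
    qed
  qed
  then show ?thesis
    unfolding determining_properties_def
    using inducing_conditions_distinct_sectors[OF I] by simp
qed

lemma determining_properties_same_sector:
  "\<lbrakk>determining_properties A D e \<C>; \<Sigma> \<in> \<C>; a \<in> \<Sigma>; b \<in> \<Sigma>; c \<in> A\<rbrakk>
    \<Longrightarrow> D a b c e \<longleftrightarrow> (\<exists>x\<in>A - \<Sigma>. D a b c x)"
  unfolding determining_properties_def by simp

lemma determining_properties_distinct_sectors:
  "\<lbrakk>determining_properties A D e \<C>; \<Sigma> \<in> \<C>; \<Sigma>' \<in> \<C>; \<Sigma> \<noteq> \<Sigma>'; a \<in> \<Sigma>; b \<in> \<Sigma>'; c \<in> A\<rbrakk>
    \<Longrightarrow> \<not> D a b c e"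
  unfolding determining_properties_def by metis

lemma one_point_extension_agrees:
  "\<lbrakk>one_point_extension A D e D'; w \<in> A; x \<in> A; y \<in> A; z \<in> A\<rbrakk> \<Longrightarrow> D' w x y z \<longleftrightarrow> D w x y z"
  unfolding one_point_extension_def by simp

text \<open>Both relations coincide on the extended set with one explicit relation,
  \<open>extend_by e D (sector_relation A D \<C>)\<close>.\<close>

lemma determining_properties_unique:
  assumes S: "splitting A D \<C>"
    and D1: "one_point_extension A D e D1" "determining_properties A D1 e \<C>"
    and D2: "one_point_extension A D e D2" "determining_properties A D2 e \<C>"
    and X: "w \<in> insert e A" "x \<in> insert e A" "y \<in> insert e A" "z \<in> insert e A"
  shows "D1 w x y z \<longleftrightarrow> D2 w x y z"
proof -
  have triple: "D' a b c e \<longleftrightarrow> sector_relation A D \<C> a b c"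
    if D': "one_point_extension A D e D'" "determining_properties A D' e \<C>"
      and A: "a \<in> A" "b \<in> A" "c \<in> A" for D' a b c
  proof -
    obtain \<Sigma> where \<Sigma>: "\<Sigma> \<in> \<C>" "a \<in> \<Sigma>" using splitting_sector_exists[OF S] A by blast
    obtain \<Sigma>' where \<Sigma>': "\<Sigma>' \<in> \<C>" "b \<in> \<Sigma>'" using splitting_sector_exists[OF S] A by blast
    show ?thesis
    proof (cases "\<Sigma> = \<Sigma>'")
      case True
      then have "D' a b c e \<longleftrightarrow> (\<exists>x\<in>A - \<Sigma>. D' a b c x)"
        using determining_properties_same_sector[OF D'(2)] \<Sigma> \<Sigma>' A by simp
      \<comment> \<open>The witnesses lie in \<open>A\<close>, where the extension agrees with
        \<open>D\<close>.\<close>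
      also have "\<dots> \<longleftrightarrow> (\<exists>x\<in>A - \<Sigma>. D a b c x)"
        using one_point_extension_agrees[OF D'(1)] A by (intro bex_cong) auto
      finally show ?thesis
        using True \<Sigma> \<Sigma>' splitting_sector_unique[OF S] unfolding sector_relation_def by metis
    next
      case False
      then have "\<not> D' a b c e"
        using determining_properties_distinct_sectors[OF D'(2)] \<Sigma> \<Sigma>' A by simp
      then show ?thesis
        using False \<Sigma> \<Sigma>' splitting_sector_unique[OF S] unfolding sector_relation_def by metis
    qed
  qed
  have "D' w x y z \<longleftrightarrow> extend_by e D (sector_relation A D \<C>) w x y z"
    if D': "one_point_extension A D e D'" "determining_properties A D' e \<C>" for D'
  proof -
    have "D_set (insert e A) D'"
      using D'(1) unfolding one_point_extension_def by simp
    then have "D' w x y z \<longleftrightarrow> extend_by e D' (\<lambda>a b c. D' a b c e) w x y z"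
      using X by (rule D_set_eq_extend_by)
    \<comment> \<open>\<open>D'\<close> may be replaced by \<open>D\<close> because the last branch
      of \<open>extend_by\<close> is reached only when all entries lie in \<open>A\<close>.\<close>
    also have "\<dots> \<longleftrightarrow> extend_by e D (sector_relation A D \<C>) w x y z"
      using X one_point_extension_agrees[OF D'(1)] triple[OF D'] unfolding extend_by_def by auto
    finally show ?thesis .
  qed
  then show ?thesis
    using D1 D2 by blast
qed

theorem mainTheorem9:
  fixes A :: "'a set" and D :: "'a \<Rightarrow> 'a \<Rightarrow> 'a \<Rightarrow> 'a \<Rightarrow> bool"
    and \<C> :: "'a set set" and e :: 'a
  assumes "D_set A D" and "finite A" and "card A \<ge> 2"
    and "splitting A D \<C>" and "e \<notin> A"
  shows "(\<exists>D'. one_point_extension A D e D' \<and> is_induced_splitting A D' e \<C>) \<and>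
    (\<forall>D'. one_point_extension A D e D' \<and> is_induced_splitting A D' e \<C> \<longrightarrow>
       determining_properties A D' e \<C>) \<and>
    (\<forall>D' D''. one_point_extension A D e D' \<and> determining_properties A D' e \<C> \<and>
       one_point_extension A D e D'' \<and> determining_properties A D'' e \<C> \<longrightarrow>
       (\<forall>w\<in>insert e A. \<forall>x\<in>insert e A. \<forall>y\<in>insert e A. \<forall>z\<in>insert e A.
          D' w x y z \<longleftrightarrow> D'' w x y z)) \<and>
    (\<forall>\<Sigma>\<in>\<C>. \<forall>a\<in>\<Sigma>. \<forall>b\<in>\<Sigma>. \<forall>c\<in>A.
       (\<exists>x\<in>A - \<Sigma>. D a b c x) \<longleftrightarrow> (\<forall>x\<in>A - \<Sigma>. D a b c x))"
proof (intro conjI)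
  note D = \<open>D_set A D\<close> and S = \<open>splitting A D \<C>\<close> and e = \<open>e \<notin> A\<close>
  let ?E = "extend_by e D (sector_relation A D \<C>)"
  have agree: "\<forall>w\<in>A. \<forall>x\<in>A. \<forall>y\<in>A. \<forall>z\<in>A. ?E w x y z \<longleftrightarrow> D w x y z"
    using e unfolding extend_by_def by auto
  have "one_point_extension A D e ?E"
    unfolding one_point_extension_def
    using e D_set_extend_by_sector_relation[OF D S e] agree by blast
  moreover have "is_induced_splitting A ?E e \<C>"
    using splitting_cong[OF agree S] inducing_conditions_sector_relation[OF S e]
    by (rule is_induced_splittingI)
  ultimately show "\<exists>D'. one_point_extension A D e D' \<and> is_induced_splitting A D' e \<C>"
    by blast
  show "\<forall>D'. one_point_extension A D e D' \<and> is_induced_splitting A D' e \<C> \<longrightarrow>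
       determining_properties A D' e \<C>"
    by (intro allI impI determining_properties_if_inducing_conditions)
      (simp_all only: one_point_extension_def is_induced_splitting_def)
  show "\<forall>D' D''. one_point_extension A D e D' \<and> determining_properties A D' e \<C> \<and>
       one_point_extension A D e D'' \<and> determining_properties A D'' e \<C> \<longrightarrow>
       (\<forall>w\<in>insert e A. \<forall>x\<in>insert e A. \<forall>y\<in>insert e A. \<forall>z\<in>insert e A.
          D' w x y z \<longleftrightarrow> D'' w x y z)"
    by (intro allI impI ballI, elim conjE) (rule determining_properties_unique[OF S])
  show "\<forall>\<Sigma>\<in>\<C>. \<forall>a\<in>\<Sigma>. \<forall>b\<in>\<Sigma>. \<forall>c\<in>A.
       (\<exists>x\<in>A - \<Sigma>. D a b c x) \<longleftrightarrow> (\<forall>x\<in>A - \<Sigma>. D a b c x)"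
    \<comment> \<open>Passing from every \<open>x\<close> to some \<open>x\<close> needs a point
      outside \<Sigma>; the converse is independence of the outside point.\<close>
    using splitting_outside_independent[OF D S] splitting_complement_nonempty[OF S] by metis
qed

end
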